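(* Let $k>0$ be a real number. For every integer $n\ge 1$ the hyperbolic $k$-Fibonacci quaternions satisfy $$\sum_{s=1}^{n}\mathbb{H}F_{k,s}=\frac{1}{k}\big(\mathbb{H}F_{k,n+1}+\mathbb{H}F_{k,n}-\mathbb{H}F_{k,1}-\mathbb{H}F_{k,0}\big),$$ $$\sum_{s=1}^{n}\mathbb{H}F_{k,2s-1}=\frac{1}{k}\big(\mathbb{H}F_{k,2n}-\mathbb{H}F_{k,0}\big),$$ $$\sum_{s=1}^{n}\mathbb{H}F_{k,2s}=\frac{1}{k}\big(\mathbb{H}F_{k,2n+1}-\mathbb{H}F_{k,1}\big).$$
   Context: For a real number $k>0$, the $k$-Fibonacci numbers are defined by $F_{k,0}=0$, $F_{k,1}=1$, $F_{k,n+1}=kF_{k,n}+F_{k,n-1}$ for $n\ge1$. The hyperbolic quaternions form the real four-dimensional algebra with basis $1,\mathbf{i},\mathbf{j},\mathbf{k}$, unit $1$, and bilinear product determined by $\mathbf{i}^2=\mathbf{j}^2=\mathbf{k}^2=1$, $\mathbf{i}\mathbf{j}=\mathbf{k}=-\mathbf{j}\mathbf{i}$, $\mathbf{j}\mathbf{k}=\mathbf{i}=-\mathbf{k}\mathbf{j}$, $\mathbf{k}\mathbf{i}=\mathbf{j}=-\mathbf{i}\mathbf{k}$. The unit $\mathbf{k}$ is distinct from the real parameter $k$. The $n$-th hyperbolic $k$-Fibonacci quaternion is $\mathbb{H}F_{k,n}=F_{k,n}+\mathbf{i}F_{k,n+1}+\mathbf{j}F_{k,n+2}+\mathbf{k}F_{k,n+3}$.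 *)

theory Defs
  imports Complex_Main
begin

fun kfib :: "real \<Rightarrow> nat \<Rightarrow> real" where
  "kfib k 0 = 0"
| "kfib k (Suc 0) = 1"
| "kfib k (Suc (Suc n)) = k * kfib k (Suc n) + kfib k n"

text \<open>
  \<open>HQuat a b c d\<close> stands for a + b i + c j + d k.  The product is not associative
  (for instance (i i) j = j but i (i j) = -j), so the type is no instance of the library's
  ring or algebra classes.  Besides the classes for the vector space it only gets the
  operations 1 and *; the lemmas below record that these form a unital bilinear product.
\<close>

datatype hquat = HQuat (hq_re: real) (hq_i: real) (hq_j: real) (hq_k: real)

instantiation hquat :: real_vector
begin

definition zero_hquat :: hquat where
  "0 = HQuat 0 0 0 0"

definition plus_hquat :: "hquat \<Rightarrow> hquat \<Rightarrow> hquat" where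
  "p + q = HQuat (hq_re p + hq_re q) (hq_i p + hq_i q) (hq_j p + hq_j q) (hq_k p + hq_k q)"

definition uminus_hquat :: "hquat \<Rightarrow> hquat" where
  "- p = HQuat (- hq_re p) (- hq_i p) (- hq_j p) (- hq_k p)"

definition minus_hquat :: "hquat \<Rightarrow> hquat \<Rightarrow> hquat" where
  "p - q = HQuat (hq_re p - hq_re q) (hq_i p - hq_i q) (hq_j p - hq_j q) (hq_k p - hq_k q)"

definition scaleR_hquat :: "real \<Rightarrow> hquat \<Rightarrow> hquat" where
  "r *\<^sub>R p = HQuat (r * hq_re p) (r * hq_i p) (r * hq_j p) (r * hq_k p)"

instance
  by standard
    (simp_all add: zero_hquat_def plus_hquat_def uminus_hquat_def minus_hquat_def
      scaleR_hquat_def algebra_simps)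

end

instantiation hquat :: "{one, times}"
begin

definition one_hquat :: hquat where
  "1 = HQuat 1 0 0 0"

definition times_hquat :: "hquat \<Rightarrow> hquat \<Rightarrow> hquat" where
  "p * q = HQuat
    (hq_re p * hq_re q + hq_i p * hq_i q + hq_j p * hq_j q + hq_k p * hq_k q)
    (hq_re p * hq_i q + hq_i p * hq_re q + hq_j p * hq_k q - hq_k p * hq_j q)
    (hq_re p * hq_j q + hq_j p * hq_re q + hq_k p * hq_i q - hq_i p * hq_k q)
    (hq_re p * hq_k q + hq_k p * hq_re q + hq_i p * hq_j q - hq_j p * hq_i q)"

instance ..

end

definition hq_ii :: hquat where "hq_ii = HQuat 0 1 0 0"
definition hq_jj :: hquat where "hq_jj = HQuat 0 0 1 0"
definition hq_kk :: hquat where "hq_kk = HQuat 0 0 0 1"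

lemmas hquat_defs = zero_hquat_def plus_hquat_def uminus_hquat_def minus_hquat_def
  scaleR_hquat_def one_hquat_def times_hquat_def hq_ii_def hq_jj_def hq_kk_def

lemma hquat_basis_expansion:
  "HQuat a b c d = a *\<^sub>R 1 + b *\<^sub>R hq_ii + c *\<^sub>R hq_jj + d *\<^sub>R hq_kk"
  by (simp add: hquat_defs)

lemma hquat_mult_basis:
  "hq_ii * hq_ii = 1" "hq_jj * hq_jj = 1" "hq_kk * hq_kk = 1"
  "hq_ii * hq_jj = hq_kk" "hq_jj * hq_ii = - hq_kk"
  "hq_jj * hq_kk = hq_ii" "hq_kk * hq_jj = - hq_ii"
  "hq_kk * hq_ii = hq_jj" "hq_ii * hq_kk = - hq_jj"
  by (simp_all add: hquat_defs)

lemma hquat_mult_bilinear: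
  fixes p q r :: hquat
  shows "1 * p = p" "p * 1 = p"
    "(p + q) * r = p * r + q * r" "p * (q + r) = p * q + p * r"
    "(a *\<^sub>R p) * q = a *\<^sub>R (p * q)" "p * (a *\<^sub>R q) = a *\<^sub>R (p * q)"
  by (simp_all add: hquat_defs algebra_simps)

definition hkfib :: "real \<Rightarrow> nat \<Rightarrow> hquat" where
  "hkfib k n = kfib k n *\<^sub>R 1 + kfib k (n + 1) *\<^sub>R hq_ii + kfib k (n + 2) *\<^sub>R hq_jj
     + kfib k (n + 3) *\<^sub>R hq_kk"

end

theory Submission
  imports Defs
begin

text \<open>
  The quaternions inherit the recurrence of the \<open>k\<close>-Fibonacci numbers componentwise, so
  \<open>k\<close> times each summand is the difference of the two neighbouring quaternions and all three sums telescope.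
\<close>

lemma hkfib_rec: "hkfib k (Suc (Suc n)) = k *\<^sub>R hkfib k (Suc n) + hkfib k n"
  by (simp add: hkfib_def hquat_defs numeral_3_eq_3 algebra_simps)

text \<open>The two neighbours of a summand lie two indices apart, so telescoping leaves two
  boundary terms at each end. Scaling by \<open>k\<close> keeps division out of the
  induction.\<close>

lemma scaleR_sum_hkfib:
  "k *\<^sub>R (\<Sum>s=1..n. hkfib k s) = hkfib k (n + 1) + hkfib k n - hkfib k 1 - hkfib k 0"
  by (induction n) (simp_all add: scaleR_add_right hkfib_rec)

text \<open>Within one parity class consecutive differences share a term, so a single term survives
  at each end. Since \<open>s\<close> starts at 1, the subtraction in \<open>2 * s - 1\<close> never
  truncates.\<close>

lemma scaleR_sum_hkfib_odd:
  "k *\<^sub>R (\<Sum>s=1..n. hkfib k (2 * s - 1)) = hkfib k (2 * n) - hkfib k 0"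
  by (induction n) (simp_all add: scaleR_add_right hkfib_rec)

lemma scaleR_sum_hkfib_even:
  "k *\<^sub>R (\<Sum>s=1..n. hkfib k (2 * s)) = hkfib k (2 * n + 1) - hkfib k 1"
  by (induction n) (simp_all add: scaleR_add_right hkfib_rec)

theorem theorem2p6:
  fixes k :: real and n :: nat
  assumes "k > 0" and "n \<ge> 1"
  shows "(\<Sum>s=1..n. hkfib k s) =
           (1 / k) *\<^sub>R (hkfib k (n + 1) + hkfib k n - hkfib k 1 - hkfib k 0) \<and>
         (\<Sum>s=1..n. hkfib k (2 * s - 1)) = (1 / k) *\<^sub>R (hkfib k (2 * n) - hkfib k 0) \<and>
         (\<Sum>s=1..n. hkfib k (2 * s)) = (1 / k) *\<^sub>R (hkfib k (2 * n + 1) - hkfib k 1)"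
proof -
  \<comment> \<open>The division postponed so far happens here: \<open>k > 0\<close> makes scaling
    by \<open>k\<close> invertible.\<close>
  have "x = (1 / k) *\<^sub>R y" if "k *\<^sub>R x = y" for x y :: hquat
    using that assms(1) by auto
  then show ?thesis
    by (intro conjI) (simp_all only: scaleR_sum_hkfib scaleR_sum_hkfib_odd scaleR_sum_hkfib_even)
qed

end
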